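(* If $S$ is an extreme ray of $H_n$, then its zero-lift $S'$ is an extreme ray of $H_{n+1}$. Hence $H_n$ is a projection of $H_{n+1}$ (namely onto the coordinates $S_I$ with $\varnothing\ne I\subseteq[n]$).
   Context: For a positive integer $k$ let $[k]=\{1,\dots,k\}$. $K_N$ is the undirected complete graph on vertex set $[N]$, with edge set $E_N=\{(i,j):1\le i<j\le N\}$. A weight map is a function $w:E_N\to\mathbb{R}_{\ge 0}$. For $W\subseteq[N]$, the cut $C(W)$ is the set of edges with exactly one endpoint in $W$, and $\|C(W)\|$ is the sum of the weights of its edges. For $1\le n<N$, a weight map $w$ on $K_N$ realizes in $K_N$ the vector $S=(S_I)_{\varnothing\ne I\subseteq[n]}\in\mathbb{R}^{2^n-1}$ with $S_I=\min\{\|C(W)\| : W\subseteq[N-1],\ W\cap[n]=I\}$. $H_n$ is the set of all $S\in\mathbb{R}^{2^n-1}$ realized by some weight map in $K_N$ for some $N>n$; it is a convex polyhedral cone. Extreme rays are identified with their nonzero generating vectors up to positive scaling. The zero-lift of $S\in\mathbb{R}^{2^n-1}$ is the vector $S'\in\mathbb{R}^{2^{n+1}-1}$ with $S'_{\{n+1\}}=0$ and $S'_{I\cup\{n+1\}}=S'_I=S_I$ for all $\varnothing\ne I\subseteq[n]$. *)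

theory Defs
  imports "HOL-Analysis.Analysis" "HOL-Analysis.Finite_Function_Topology"
begin

definition complete_edges :: "nat \<Rightarrow> (nat \<times> nat) set" where
  "complete_edges N = {(i, j). 1 \<le> i \<and> i < j \<and> j \<le> N}"

(* A weight map is a total function; only its values on complete_edges N matter. *)
definition weight_map :: "nat \<Rightarrow> (nat \<times> nat \<Rightarrow> real) \<Rightarrow> bool" where
  "weight_map N w \<longleftrightarrow> (\<forall>e \<in> complete_edges N. 0 \<le> w e)"

definition cut :: "nat \<Rightarrow> nat set \<Rightarrow> (nat \<times> nat) set" where
  "cut N W = {(i, j) \<in> complete_edges N. (i \<in> W) \<noteq> (j \<in> W)}"

definition cut_weight :: "nat \<Rightarrow> (nat \<times> nat \<Rightarrow> real) \<Rightarrow> nat set \<Rightarrow> real" where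
  "cut_weight N w W = (\<Sum>e \<in> cut N W. w e)"

definition indices :: "nat \<Rightarrow> nat set set" where
  "indices n = {I. I \<noteq> {} \<and> I \<subseteq> {1..n}}"

(* The space of real vectors with one coordinate for each nonempty I \<subseteq> {1..n}, for every n
   inside one real vector space: finitely supported families whose support lies in indices n. *)
type_synonym set_vector = "nat set \<Rightarrow>\<^sub>0 real"

definition vectors :: "nat \<Rightarrow> set_vector set" where
  "vectors n = {S. Poly_Mapping.keys S \<subseteq> indices n}"

definition realizes :: "nat \<Rightarrow> nat \<Rightarrow> (nat \<times> nat \<Rightarrow> real) \<Rightarrow> set_vector \<Rightarrow> bool" where
  "realizes N n w S \<longleftrightarrow> S \<in> vectors n \<and>
     (\<forall>I \<in> indices n. Poly_Mapping.lookup S I =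
        Min {cut_weight N w W | W. W \<subseteq> {1..N - 1} \<and> W \<inter> {1..n} = I})"

definition mincut_cone :: "nat \<Rightarrow> set_vector set" where
  "mincut_cone n = {S. \<exists>N w. n < N \<and> weight_map N w \<and> realizes N n w S}"

(* The nonzero vector S generates an extreme ray of the convex cone C: the closed half-line
   {c *\<^sub>R S | c \<ge> 0} is a face of C. *)
definition extreme_ray :: "'a::real_vector set \<Rightarrow> 'a \<Rightarrow> bool" where
  "extreme_ray C S \<longleftrightarrow> S \<noteq> 0 \<and> (cone hull {S}) face_of C"

lemma finite_indices [simp]: "finite (indices n)"
  by (rule finite_subset[of _ "Pow {1..n}"]) (auto simp: indices_def)

lift_definition zero_lift :: "nat \<Rightarrow> set_vector \<Rightarrow> set_vector" is
  "\<lambda>n S J. if J \<in> indices (n + 1) \<and> J \<noteq> {n + 1} then S (J - {n + 1}) else 0"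
  by (rule finite_subset[OF _ finite_indices]) (auto split: if_splits)

lift_definition coord_proj :: "nat \<Rightarrow> set_vector \<Rightarrow> set_vector" is
  "\<lambda>n S I. if I \<in> indices n then S I else 0"
  by (rule finite_subset[OF _ finite_indices]) (auto split: if_splits)

lemma zero_lift_in_vectors: "zero_lift n S \<in> vectors (n + 1)"
  by (auto simp: vectors_def in_keys_iff zero_lift.rep_eq split: if_splits)

lemma lookup_zero_lift_new: "Poly_Mapping.lookup (zero_lift n S) {n + 1} = 0"
  by (simp add: zero_lift.rep_eq)

lemma lookup_zero_lift:
  assumes "I \<in> indices n"
  shows "Poly_Mapping.lookup (zero_lift n S) I = Poly_Mapping.lookup S I"
    and "Poly_Mapping.lookup (zero_lift n S) (I \<union> {n + 1}) = Poly_Mapping.lookup S I"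
proof -
  have I: "I \<noteq> {}" "I \<subseteq> {1..n}" "n + 1 \<notin> I"
    using assms by (auto simp: indices_def)
  then have "I \<in> indices (n + 1)" "I \<union> {n + 1} \<in> indices (n + 1)"
    and "I \<noteq> {n + 1}" "I \<union> {n + 1} \<noteq> {n + 1}"
    and "I - {n + 1} = I" "(I \<union> {n + 1}) - {n + 1} = I"
    by (auto simp: indices_def)
  then show "Poly_Mapping.lookup (zero_lift n S) I = Poly_Mapping.lookup S I"
    and "Poly_Mapping.lookup (zero_lift n S) (I \<union> {n + 1}) = Poly_Mapping.lookup S I"
    by (simp_all only: zero_lift.rep_eq) simp_all
qed

end

(* The zero-lift of a realizable vector is realized by inserting an isolated vertex n + 1.
   Conversely, if the coordinate {n + 1} of a realizable vector vanishes, some cut U of weight 0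
   separates n + 1 from all other terminals, and adding U to a set or removing U from it does not
   increase the weight of its cut. So the vectors of the (n + 1)-st cone with vanishing coordinate
   {n + 1} are exactly the zero-lifts of the vectors of the n-th cone, and since this coordinate is
   nonnegative they form a face. For the projection, a sufficiently heavy edge from n + 1 to the
   sink N forces n + 1 onto the side of the sink. *)
theory Submission
  imports Defs
begin

section \<open>Cut weights and minimum cuts\<close>

text \<open>This names the minimum in \<open>realizes\<close>, so that it can be compared between
  networks. It also makes sense for the empty trace \<open>I = {}\<close>, which is not an element
  of \<open>indices n\<close>.\<close>

definition min_cut :: "nat \<Rightarrow> nat \<Rightarrow> (nat \<times> nat \<Rightarrow> real) \<Rightarrow> nat set \<Rightarrow> real" where
  "min_cut N n w I = Min {cut_weight N w W | W. W \<subseteq> {1..N - 1} \<and> W \<inter> {1..n} = I}"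

lemma mem_mincut_cone_iff:
  "S \<in> mincut_cone n \<longleftrightarrow> S \<in> vectors n \<and>
     (\<exists>N w. n < N \<and> weight_map N w \<and> (\<forall>I \<in> indices n. Poly_Mapping.lookup S I = min_cut N n w I))"
  unfolding mincut_cone_def realizes_def min_cut_def by blast

lemma finite_complete_edges [simp]: "finite (complete_edges N)"
  by (rule finite_subset[of _ "{1..N} \<times> {1..N}"]) (auto simp: complete_edges_def)

lemma cut_subset: "cut N W \<subseteq> complete_edges N"
  by (auto simp: cut_def)

lemma finite_cut [simp]: "finite (cut N W)"
  using cut_subset finite_complete_edges finite_subset by blast

lemma cut_weight_nonneg:
  assumes "weight_map N w"
  shows "0 \<le> cut_weight N w W"
  unfolding cut_weight_def using assms cut_subset by (intro sum_nonneg) (auto simp: weight_map_def)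

lemma cut_weight_empty [simp]: "cut_weight N w {} = 0"
  by (simp add: cut_weight_def cut_def)

text \<open>By inclusion-exclusion, the union of two cuts weighs the sum of both weights minus the
  weight of the intersection. As weights are nonnegative, the intersection may be dropped and the
  union replaced by a subset. Unions and differences of vertex sets are the two instances.\<close>

lemma cut_weight_subadditive:
  assumes "weight_map N w" and "cut N X \<subseteq> cut N W \<union> cut N U"
  shows "cut_weight N w X \<le> cut_weight N w W + cut_weight N w U"
proof -
  have nonneg: "0 \<le> w e" if "e \<in> cut N Y" for e Y
    using that assms(1) cut_subset by (auto simp: weight_map_def)
  have "cut_weight N w X \<le> sum w (cut N W \<union> cut N U)"
    unfolding cut_weight_def using assms(2) nonneg by (intro sum_mono2) auto
  also have "\<dots> = sum w (cut N W) + sum w (cut N U) - sum w (cut N W \<inter> cut N U)"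
    by (rule sum_Un) simp_all
  also have "\<dots> \<le> sum w (cut N W) + sum w (cut N U)"
    using nonneg by (auto intro: sum_nonneg)
  finally show ?thesis by (simp add: cut_weight_def)
qed

lemma cut_weight_Un_le:
  assumes "weight_map N w"
  shows "cut_weight N w (W \<union> U) \<le> cut_weight N w W + cut_weight N w U"
  by (rule cut_weight_subadditive[OF assms]) (auto simp: cut_def)

lemma cut_weight_Diff_le:
  assumes "weight_map N w"
  shows "cut_weight N w (W - U) \<le> cut_weight N w W + cut_weight N w U"
  by (rule cut_weight_subadditive[OF assms]) (auto simp: cut_def)

lemma finite_cut_weights:
  "finite {cut_weight N w W | W. W \<subseteq> {1..N - 1} \<and> W \<inter> {1..n} = I}"
  by (rule finite_subset[of _ "cut_weight N w ` Pow {1..N - 1}"]) auto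

lemma min_cut_le:
  assumes "W \<subseteq> {1..N - 1}" and "W \<inter> {1..n} = I"
  shows "min_cut N n w I \<le> cut_weight N w W"
  unfolding min_cut_def using assms by (intro Min_le finite_cut_weights) auto

lemma min_cut_attained:
  assumes "n < N" and "I \<subseteq> {1..n}"
  obtains W where "W \<subseteq> {1..N - 1}" "W \<inter> {1..n} = I" "min_cut N n w I = cut_weight N w W"
proof -
  \<comment> \<open>As \<open>n < N\<close>, the set \<open>I\<close> is itself admissible, so the
    minimum ranges over a nonempty set.\<close>
  have "I \<subseteq> {1..N - 1} \<and> I \<inter> {1..n} = I"
    using assms by fastforce
  then have "{cut_weight N w W | W. W \<subseteq> {1..N - 1} \<and> W \<inter> {1..n} = I} \<noteq> {}"
    by blast
  from Min_in[OF finite_cut_weights this] show ?thesis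
    using that unfolding min_cut_def by auto
qed

text \<open>The minimum on the right is attained, so it suffices to turn every set admissible there
  into one admissible on the left whose cut is no heavier. Network and terminals may differ on the
  two sides; the comparisons of minimum cuts below have this form.\<close>

lemma min_cut_mono:
  assumes "n < N" and "I \<subseteq> {1..n}"
    and "\<And>W. W \<subseteq> {1..N - 1} \<Longrightarrow> W \<inter> {1..n} = I \<Longrightarrow>
      \<exists>W'. W' \<subseteq> {1..N' - 1} \<and> W' \<inter> {1..n'} = I' \<and> cut_weight N' w' W' \<le> cut_weight N w W"
  shows "min_cut N' n' w' I' \<le> min_cut N n w I"
proof -
  obtain W where W: "W \<subseteq> {1..N - 1}" "W \<inter> {1..n} = I" "min_cut N n w I = cut_weight N w W"
    using min_cut_attained[OF assms(1,2)] by blast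
  obtain W' where "W' \<subseteq> {1..N' - 1}" "W' \<inter> {1..n'} = I'" "cut_weight N' w' W' \<le> cut_weight N w W"
    using assms(3)[OF W(1,2)] by blast
  then show ?thesis
    using min_cut_le[of W' N' n' I' w'] W(3) by simp
qed

lemma min_cut_nonneg:
  assumes "weight_map N w" and "n < N" and "I \<subseteq> {1..n}"
  shows "0 \<le> min_cut N n w I"
proof -
  obtain W where "min_cut N n w I = cut_weight N w W"
    using min_cut_attained[OF assms(2,3)] by blast
  then show ?thesis using cut_weight_nonneg[OF assms(1)] by simp
qed

lemma min_cut_empty:
  assumes "weight_map N w" and "n < N"
  shows "min_cut N n w {} = 0"
  using min_cut_nonneg[OF assms, of "{}"] min_cut_le[of "{}" N n "{}" w] by simp

section \<open>Inserting an isolated vertex\<close>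

text \<open>The increasing map that makes room for a new vertex \<open>n + 1\<close>: terminals up
  to \<open>n\<close> stay fixed, all later vertices move up by one. For \<open>n < N\<close> the
  sink \<open>N\<close> becomes the new sink \<open>N + 1\<close>.\<close>

definition skip :: "nat \<Rightarrow> nat \<Rightarrow> nat" where
  "skip n i = (if i \<le> n then i else i + 1)"

text \<open>A left inverse of \<open>skip\<close>. At the new vertex \<open>n + 1\<close> it takes
  the default value \<open>n\<close>, which \<open>isolate\<close> never consults.\<close>

definition unskip :: "nat \<Rightarrow> nat \<Rightarrow> nat" where
  "unskip n i = (if i \<le> n then i else i - 1)"

lemma unskip_skip [simp]: "unskip n (skip n i) = i"
  by (simp add: skip_def unskip_def)

lemma skip_unskip: "i \<noteq> n + 1 \<Longrightarrow> skip n (unskip n i) = i"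
  by (auto simp: skip_def unskip_def)

lemma skip_neq [simp]: "skip n i \<noteq> Suc n"
  by (simp add: skip_def)

lemma inj_skip: "inj (skip n)"
  by (metis injI unskip_skip)

definition isolate :: "nat \<Rightarrow> (nat \<times> nat \<Rightarrow> real) \<Rightarrow> nat \<times> nat \<Rightarrow> real" where
  "isolate n w = (\<lambda>(i, j). if i = n + 1 \<or> j = n + 1 then 0 else w (unskip n i, unskip n j))"

lemma skip_mem_complete_edges_iff:
  assumes "n < N"
  shows "(skip n i, skip n j) \<in> complete_edges (N + 1) \<longleftrightarrow> (i, j) \<in> complete_edges N"
  using assms by (auto simp: complete_edges_def skip_def)

lemma weight_map_isolate:
  assumes "weight_map N w" and "n < N"
  shows "weight_map (N + 1) (isolate n w)"
  unfolding weight_map_def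
proof
  fix e assume e: "e \<in> complete_edges (N + 1)"
  obtain i j where ij: "e = (i, j)" by fastforce
  show "0 \<le> isolate n w e"
  proof (cases "i = n + 1 \<or> j = n + 1")
    case False
    then have "(unskip n i, unskip n j) \<in> complete_edges N"
      using skip_mem_complete_edges_iff[OF assms(2), of "unskip n i" "unskip n j"] e ij
      by (simp add: skip_unskip)
    then show ?thesis using False ij assms(1) by (simp add: isolate_def weight_map_def)
  qed (auto simp: ij isolate_def)
qed

text \<open>Edges at \<open>n + 1\<close> weigh nothing. The others are the images of the edges of
  the smaller graph under \<open>skip\<close>, which is injective and keeps the order of endpoints,
  so the sum can be reindexed.\<close>

lemma cut_weight_isolate:
  assumes "n < N"
  shows "cut_weight (N + 1) (isolate n w) W = cut_weight N w (skip n -` W)"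
proof -
  let ?g = "map_prod (skip n) (skip n)"
  have sub: "?g ` cut N (skip n -` W) \<subseteq> cut (N + 1) W"
    using skip_mem_complete_edges_iff[OF assms] by (auto simp: cut_def)
  have zero: "isolate n w e = 0" if "e \<in> cut (N + 1) W - ?g ` cut N (skip n -` W)" for e
  proof (rule ccontr)
    assume nz: "isolate n w e \<noteq> 0"
    obtain i j where ij: "e = (i, j)" by fastforce
    with nz have "i \<noteq> n + 1" "j \<noteq> n + 1" by (auto simp: isolate_def)
    then have eq: "e = ?g (unskip n i, unskip n j)" by (simp add: ij skip_unskip)
    with that have "(unskip n i, unskip n j) \<in> cut N (skip n -` W)"
      using skip_mem_complete_edges_iff[OF assms] by (auto simp: cut_def)
    with eq that show False by blast
  qed
  have "cut_weight (N + 1) (isolate n w) W = sum (isolate n w) (?g ` cut N (skip n -` W))"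
    unfolding cut_weight_def using sub zero by (intro sum.mono_neutral_right) auto
  also have "\<dots> = sum (isolate n w \<circ> ?g) (cut N (skip n -` W))"
    by (intro sum.reindex inj_on_subset[OF prod.inj_map[OF inj_skip inj_skip]]) simp
  also have "\<dots> = cut_weight N w (skip n -` W)"
    unfolding cut_weight_def by (intro sum.cong) (auto simp: isolate_def)
  finally show ?thesis .
qed

text \<open>Preimages under \<open>skip\<close> do not see the new vertex, so it can be put on
  either side of a cut for free.\<close>

lemma min_cut_isolate:
  assumes "n < N" and "J \<subseteq> {1..n + 1}"
  shows "min_cut (N + 1) (n + 1) (isolate n w) J = min_cut N n w (J - {n + 1})"
proof (rule antisym)
  show "min_cut N n w (J - {n + 1}) \<le> min_cut (N + 1) (n + 1) (isolate n w) J"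
  proof (rule min_cut_mono)
    fix W assume W: "W \<subseteq> {1..N + 1 - 1}" "W \<inter> {1..n + 1} = J"
    have "skip n -` W \<subseteq> {1..N - 1}"
      using W(1) assms(1) by (fastforce simp: skip_def split: if_splits)
    moreover have "skip n -` W \<inter> {1..n} = J - {n + 1}"
      using W(2) by (auto simp: skip_def)
    ultimately show "\<exists>W'\<subseteq>{1..N - 1}. W' \<inter> {1..n} = J - {n + 1} \<and>
        cut_weight N w W' \<le> cut_weight (N + 1) (isolate n w) W"
      using cut_weight_isolate[OF assms(1), of w W] by auto
  qed (use assms in auto)
  show "min_cut (N + 1) (n + 1) (isolate n w) J \<le> min_cut N n w (J - {n + 1})"
  proof (rule min_cut_mono)
    fix W assume W: "W \<subseteq> {1..N - 1}" "W \<inter> {1..n} = J - {n + 1}"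
    \<comment> \<open>The transported set, with the new vertex added exactly when \<open>J\<close>
      prescribes it. Its preimage under \<open>skip\<close> is again \<open>W\<close>.\<close>
    let ?W = "skip n ` W \<union> (J \<inter> {n + 1})"
    have pre: "skip n -` ?W = W"
      using inj_skip[of n] by (auto simp: inj_def)
    have "?W \<subseteq> {1..N + 1 - 1}"
      using W(1) assms(1) by (fastforce simp: skip_def)
    moreover have "?W \<inter> {1..n + 1} = J"
    proof (rule set_eqI)
      fix i show "i \<in> ?W \<inter> {1..n + 1} \<longleftrightarrow> i \<in> J"
      proof (cases "i = n + 1")
        case False
        then have "i \<in> ?W \<inter> {1..n + 1} \<longleftrightarrow> i \<in> skip n ` W \<and> i \<in> {1..n}"
          by (auto simp: le_Suc_eq)
        also have "\<dots> \<longleftrightarrow> i \<in> W \<inter> {1..n}" by (force simp: skip_def)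
        also have "\<dots> \<longleftrightarrow> i \<in> J - {n + 1}" by (simp only: W(2))
        finally show ?thesis using False by blast
      qed (use skip_neq[of n] assms(2) in fastforce)
    qed
    moreover have "cut_weight (N + 1) (isolate n w) ?W \<le> cut_weight N w W"
      by (simp only: cut_weight_isolate[OF assms(1)] pre order_refl)
    ultimately show "\<exists>W'\<subseteq>{1..N + 1 - 1}. W' \<inter> {1..n + 1} = J \<and>
        cut_weight (N + 1) (isolate n w) W' \<le> cut_weight N w W"
      by blast
  qed (use assms in auto)
qed

section \<open>Zero-lifts of realizable vectors\<close>

lemma atLeastAtMost_add_one: "{1..n + 1} = insert (n + 1) {1..n}" for n :: nat
  by auto

lemma Diff_mem_indices:
  assumes "J \<in> indices (n + 1)" and "J \<noteq> {n + 1}"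
  shows "J - {n + 1} \<in> indices n"
  using assms by (fastforce simp: indices_def le_Suc_eq)

lemma indices_Suc: "I \<in> indices n \<Longrightarrow> I \<in> indices (n + 1)"
  by (auto simp: indices_def)

lemma lookup_eq_0: "S \<in> vectors n \<Longrightarrow> I \<notin> indices n \<Longrightarrow> Poly_Mapping.lookup S I = 0"
  by (auto simp: vectors_def in_keys_iff)

lemma zero_lift_mem_mincut_cone:
  assumes "S \<in> mincut_cone n"
  shows "zero_lift n S \<in> mincut_cone (n + 1)"
proof -
  obtain N w where N: "n < N" and w: "weight_map N w"
    and S: "\<And>I. I \<in> indices n \<Longrightarrow> Poly_Mapping.lookup S I = min_cut N n w I"
    using assms by (auto simp: mem_mincut_cone_iff)
  have "Poly_Mapping.lookup (zero_lift n S) J = min_cut (N + 1) (n + 1) (isolate n w) J"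
    if J: "J \<in> indices (n + 1)" for J
  proof -
    have "min_cut (N + 1) (n + 1) (isolate n w) J = min_cut N n w (J - {n + 1})"
      using J by (intro min_cut_isolate[OF N]) (simp add: indices_def)
    \<comment> \<open>For \<open>J = {n + 1}\<close> the remaining trace is empty, and the minimum
      cut 0 agrees with the zero prescribed by the lift.\<close>
    then show ?thesis
      using J S[OF Diff_mem_indices[OF J]] min_cut_empty[OF w N] by (auto simp: zero_lift.rep_eq)
  qed
  then show ?thesis
    using zero_lift_in_vectors weight_map_isolate[OF w N] N
    unfolding mem_mincut_cone_iff by (metis add_less_mono1)
qed

section \<open>The coordinate projection and the vector operations\<close>

lemma coord_proj_in_vectors: "coord_proj n S \<in> vectors n"
  by (auto simp: vectors_def in_keys_iff coord_proj.rep_eq split: if_splits)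

lemma coord_proj_zero_lift:
  assumes "S \<in> vectors n"
  shows "coord_proj n (zero_lift n S) = S"
  using lookup_eq_0[OF assms] lookup_zero_lift
  by (intro poly_mapping_eqI) (auto simp: coord_proj.rep_eq)

lemma lookup_scaleR: "Poly_Mapping.lookup (c *\<^sub>R S) I = c * Poly_Mapping.lookup S I"
  for S :: "'a \<Rightarrow>\<^sub>0 real"
proof -
  \<comment> \<open>Finite support is what lets \<open>lookup\<close> be evaluated on the family
    defining the scalar multiple.\<close>
  have "finite {I. c *\<^sub>R Poly_Mapping.lookup S I \<noteq> 0}"
    by (rule finite_subset[OF _ finite_keys[of S]]) (auto simp: in_keys_iff)
  then show ?thesis by (simp add: scaleR_poly_mapping_def)
qed

lemma zero_lift_scaleR: "zero_lift n (c *\<^sub>R S) = c *\<^sub>R zero_lift n S"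
  by (intro poly_mapping_eqI) (simp add: zero_lift.rep_eq lookup_scaleR)

lemma coord_proj_scaleR: "coord_proj n (c *\<^sub>R S) = c *\<^sub>R coord_proj n S"
  by (intro poly_mapping_eqI) (simp add: coord_proj.rep_eq lookup_scaleR)

lemma coord_proj_add: "coord_proj n (S + T) = coord_proj n S + coord_proj n T"
  by (intro poly_mapping_eqI) (simp add: coord_proj.rep_eq lookup_add)

lemma lookup_mincut_cone_nonneg:
  assumes "S \<in> mincut_cone n"
  shows "0 \<le> Poly_Mapping.lookup S I"
proof (cases "I \<in> indices n")
  case True
  then show ?thesis
    using assms min_cut_nonneg[where I = I and n = n] by (auto simp: mem_mincut_cone_iff indices_def)
next
  case False
  then show ?thesis
    using assms lookup_eq_0[of S n I] by (simp add: mem_mincut_cone_iff)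
qed

section \<open>Vectors whose coordinate \<open>{n + 1}\<close> vanishes\<close>

text \<open>The network that realizes \<open>S\<close> also realizes the projection once
  \<open>n + 1\<close> is demoted to an ordinary vertex: a free cut around \<open>n + 1\<close>
  makes its side irrelevant.\<close>

lemma zero_lift_coord_proj:
  assumes S: "S \<in> mincut_cone (n + 1)" and zero: "Poly_Mapping.lookup S {n + 1} = 0"
  shows "coord_proj n S \<in> mincut_cone n" and "zero_lift n (coord_proj n S) = S"
proof -
  obtain N w where N: "n + 1 < N" and w: "weight_map N w"
    and lookup: "\<And>I. I \<in> indices (n + 1) \<Longrightarrow> Poly_Mapping.lookup S I = min_cut N (n + 1) w I"
    using S by (auto simp: mem_mincut_cone_iff)
  have S_vec: "S \<in> vectors (n + 1)"
    using S by (simp add: mem_mincut_cone_iff)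
  have "min_cut N (n + 1) w {n + 1} = 0"
    using zero lookup[of "{n + 1}"] by (simp add: indices_def)
  then obtain U where U: "U \<subseteq> {1..N - 1}" "U \<inter> {1..n + 1} = {n + 1}" "cut_weight N w U = 0"
    using min_cut_attained[OF N, of "{n + 1}" w] by auto
  have U': "U \<inter> {1..n} = {}" "n + 1 \<in> U"
  proof -
    have "{1..n} \<subseteq> {1..n + 1} - {n + 1}" by auto
    then show "U \<inter> {1..n} = {}" using U(2) by blast
    show "n + 1 \<in> U" using U(2) by blast
  qed
  \<comment> \<open>Demoting \<open>n + 1\<close> only enlarges the family of admissible sets,
    whichever side \<open>J\<close> assigns to it.\<close>
  have restrict: "min_cut N n w I \<le> min_cut N (n + 1) w J"
    if "J \<subseteq> {1..n + 1}" "J \<inter> {1..n} = I" for I J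
  proof (rule min_cut_mono)
    fix W assume "W \<subseteq> {1..N - 1}" "W \<inter> {1..n + 1} = J"
    then show "\<exists>W'\<subseteq>{1..N - 1}. W' \<inter> {1..n} = I \<and> cut_weight N w W' \<le> cut_weight N w W"
      using that(2) unfolding atLeastAtMost_add_one by (intro exI[of _ W]) blast
  qed (use N that in simp_all)
  \<comment> \<open>\<open>U\<close> contains \<open>n + 1\<close> and no other terminal, so
    subtracting it takes \<open>n + 1\<close> out and keeps the trace on \<open>{1..n}\<close>.
    Adding it, in the next step, puts \<open>n + 1\<close> in.\<close>
  have remove: "min_cut N (n + 1) w I \<le> min_cut N n w I" if "I \<subseteq> {1..n}" for I
  proof (rule min_cut_mono)
    fix W assume "W \<subseteq> {1..N - 1}" "W \<inter> {1..n} = I"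
    then have "W - U \<subseteq> {1..N - 1}" "(W - U) \<inter> {1..n + 1} = I"
      using U' unfolding atLeastAtMost_add_one by blast+
    moreover have "cut_weight N w (W - U) \<le> cut_weight N w W"
      using cut_weight_Diff_le[OF w, of W U] U(3) by simp
    ultimately show "\<exists>W'\<subseteq>{1..N - 1}. W' \<inter> {1..n + 1} = I \<and>
        cut_weight N w W' \<le> cut_weight N w W"
      by blast
  qed (use N that in auto)
  have insert: "min_cut N (n + 1) w (I \<union> {n + 1}) \<le> min_cut N n w I" if "I \<subseteq> {1..n}" for I
  proof (rule min_cut_mono)
    fix W assume "W \<subseteq> {1..N - 1}" "W \<inter> {1..n} = I"
    then have "W \<union> U \<subseteq> {1..N - 1}" "(W \<union> U) \<inter> {1..n + 1} = I \<union> {n + 1}"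
      using U' U(1) unfolding atLeastAtMost_add_one by blast+
    moreover have "cut_weight N w (W \<union> U) \<le> cut_weight N w W"
      using cut_weight_Un_le[OF w, of W U] U(3) by simp
    ultimately show "\<exists>W'\<subseteq>{1..N - 1}. W' \<inter> {1..n + 1} = I \<union> {n + 1} \<and>
        cut_weight N w W' \<le> cut_weight N w W"
      by blast
  qed (use N that in auto)
  \<comment> \<open>This includes \<open>J = {n + 1}\<close>, where the trace on the right is
    empty.\<close>
  have proj: "Poly_Mapping.lookup S J = min_cut N n w (J - {n + 1})"
    if "J \<in> indices (n + 1)" for J
  proof -
    have J: "J \<subseteq> {1..n + 1}"
      using that by (simp add: indices_def)
    have "n + 1 \<notin> {1..n}" by simp
    then have J': "J - {n + 1} \<subseteq> {1..n}" "J \<inter> {1..n} = J - {n + 1}"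
      using J unfolding atLeastAtMost_add_one by blast+
    have "min_cut N (n + 1) w J \<le> min_cut N n w (J - {n + 1})"
    proof (cases "n + 1 \<in> J")
      case True
      then have "J - {n + 1} \<union> {n + 1} = J" by auto
      then show ?thesis using insert[OF J'(1)] by metis
    next
      case False
      then have "J - {n + 1} = J" by auto
      then show ?thesis using remove[OF J'(1)] by metis
    qed
    with restrict[OF J J'(2)] lookup[OF that] show ?thesis by simp
  qed
  have proj': "Poly_Mapping.lookup S I = min_cut N n w I" if "I \<in> indices n" for I
  proof -
    have "I - {n + 1} = I" using that by (auto simp: indices_def)
    then show ?thesis using proj[OF indices_Suc[OF that]] by metis
  qed
  show "coord_proj n S \<in> mincut_cone n"
    unfolding mem_mincut_cone_iff
    using N w proj'
    by (intro conjI coord_proj_in_vectors exI[of _ N] exI[of _ w]) (auto simp: coord_proj.rep_eq)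
  show "zero_lift n (coord_proj n S) = S"
  proof (rule poly_mapping_eqI)
    \<comment> \<open>Three cases: outside \<open>indices (n + 1)\<close> both sides are 0; at
      \<open>{n + 1}\<close> the hypothesis applies; elsewhere \<open>S\<close> takes the same value
      at \<open>J\<close> and at \<open>J - {n + 1}\<close>.\<close>
    fix J
    show "Poly_Mapping.lookup (zero_lift n (coord_proj n S)) J = Poly_Mapping.lookup S J"
      using lookup_eq_0[OF S_vec, of J] zero Diff_mem_indices[of J n] proj[of J] proj'[of "J - {n + 1}"]
      by (auto simp: zero_lift.rep_eq coord_proj.rep_eq)
  qed
qed

section \<open>Projecting an arbitrary realizable vector\<close>

text \<open>The coordinate \<open>{n + 1}\<close> may be positive here, so demoting
  \<open>n + 1\<close> could lower the minimum cuts. Making it too costly to place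
  \<open>n + 1\<close> away from the sink prevents this.\<close>

lemma coord_proj_mem_mincut_cone:
  assumes S: "S \<in> mincut_cone (n + 1)"
  shows "coord_proj n S \<in> mincut_cone n"
proof -
  obtain N w where N: "n + 1 < N" and w: "weight_map N w"
    and lookup: "\<And>I. I \<in> indices (n + 1) \<Longrightarrow> Poly_Mapping.lookup S I = min_cut N (n + 1) w I"
    using S by (auto simp: mem_mincut_cone_iff)
  \<comment> \<open>The total weight \<open>?T\<close> bounds every cut of the original network. The
    edge \<open>?e\<close> joins \<open>n + 1\<close> to the sink, and since the sink is in no
    admissible set, \<open>?e\<close> is cut exactly when \<open>n + 1\<close> is in the
    set.\<close>
  let ?T = "sum w (complete_edges N)" and ?e = "(n + 1, N)"
  let ?w = "w(?e := w ?e + ?T)"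
  have T: "0 \<le> ?T"
    using w by (intro sum_nonneg) (auto simp: weight_map_def)
  have w': "weight_map N ?w"
    using w T by (auto simp: weight_map_def)
  have weight_le: "cut_weight N w W \<le> ?T" for W
    unfolding cut_weight_def using w cut_subset
    by (intro sum_mono2) (auto simp: weight_map_def)
  have weight_same: "cut_weight N ?w W = cut_weight N w W" if "n + 1 \<notin> W" "W \<subseteq> {1..N - 1}" for W
  proof -
    have "?e \<notin> cut N W" using that N by (auto simp: cut_def)
    then show ?thesis unfolding cut_weight_def by (intro sum.cong) auto
  qed
  have weight_ge: "?T \<le> cut_weight N ?w W" if "n + 1 \<in> W" "W \<subseteq> {1..N - 1}" for W
  proof -
    have e: "?e \<in> cut N W" using that N by (auto simp: cut_def complete_edges_def)
    have "?T \<le> ?w ?e" using w e cut_subset by (auto simp: weight_map_def)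
    also have "\<dots> \<le> cut_weight N ?w W"
      unfolding cut_weight_def
      using w' cut_subset unfolding weight_map_def
      by (intro member_le_sum[OF e _ finite_cut]) blast
    finally show ?thesis .
  qed
  have "min_cut N (n + 1) w I = min_cut N n ?w I" if I: "I \<in> indices n" for I
  proof (rule antisym)
    have I': "I \<subseteq> {1..n}" "n + 1 \<notin> I" using I by (auto simp: indices_def)
    show "min_cut N (n + 1) w I \<le> min_cut N n ?w I"
    proof (rule min_cut_mono)
      fix W assume W: "W \<subseteq> {1..N - 1}" "W \<inter> {1..n} = I"
      \<comment> \<open>If \<open>n + 1\<close> is in \<open>W\<close>, the new weight is at least
        \<open>?T\<close>, hence at least the old weight of any cut. Otherwise the set and its cut
        weight are unchanged.\<close>
      have "cut_weight N w (W - {n + 1}) \<le> cut_weight N ?w W"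
      proof (cases "n + 1 \<in> W")
        case True
        then show ?thesis using weight_le weight_ge[OF _ W(1)] order_trans by blast
      next
        case False
        then show ?thesis using weight_same[OF _ W(1)] by simp
      qed
      moreover have "(W - {n + 1}) \<inter> {1..n + 1} = I"
        using W(2) I' unfolding atLeastAtMost_add_one by blast
      moreover have "W - {n + 1} \<subseteq> {1..N - 1}"
        using W(1) by blast
      ultimately show "\<exists>W'\<subseteq>{1..N - 1}. W' \<inter> {1..n + 1} = I \<and> cut_weight N w W' \<le> cut_weight N ?w W"
        by (intro exI[of _ "W - {n + 1}"] conjI)
    qed (use N I' in auto)
    show "min_cut N n ?w I \<le> min_cut N (n + 1) w I"
    proof (rule min_cut_mono)
      fix W assume W: "W \<subseteq> {1..N - 1}" "W \<inter> {1..n + 1} = I"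
      \<comment> \<open>The trace \<open>I\<close> omits \<open>n + 1\<close>, so the heavy edge is
        not cut.\<close>
      then have "n + 1 \<notin> W" and "W \<inter> {1..n} = I"
        using I' unfolding atLeastAtMost_add_one by blast+
      moreover have "cut_weight N ?w W \<le> cut_weight N w W"
        using weight_same[OF \<open>n + 1 \<notin> W\<close> W(1)] by (rule eq_refl)
      ultimately show "\<exists>W'\<subseteq>{1..N - 1}. W' \<inter> {1..n} = I \<and> cut_weight N ?w W' \<le> cut_weight N w W"
        using W(1) by (intro exI[of _ W] conjI)
    qed (use N I' in auto)
  qed
  then have "\<forall>I \<in> indices n. Poly_Mapping.lookup (coord_proj n S) I = min_cut N n ?w I"
    using lookup indices_Suc by (simp add: coord_proj.rep_eq)
  then show ?thesis
    unfolding mem_mincut_cone_iff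
    using N w' by (intro conjI coord_proj_in_vectors exI[of _ N] exI[of _ ?w]) simp_all
qed

section \<open>Extreme rays\<close>

lemma cone_hull_singleton: "cone hull {S} = {c *\<^sub>R S | c. 0 \<le> c}"
  by (auto simp: cone_hull_expl)

text \<open>If a segment in the larger cone has an interior point on the lifted ray, both endpoints
  have vanishing coordinate \<open>{n + 1}\<close> and are therefore zero-lifts. The face property
  of the original ray applies to their projections, and lifting returns the endpoints.\<close>

lemma extreme_ray_zero_lift:
  assumes "extreme_ray (mincut_cone n) S"
  shows "extreme_ray (mincut_cone (n + 1)) (zero_lift n S)"
proof -
  have "S \<noteq> 0" and face: "cone hull {S} face_of mincut_cone n"
    using assms by (simp_all add: extreme_ray_def)
  have ray_sub: "c *\<^sub>R S \<in> mincut_cone n" if "0 \<le> c" for c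
    using face_of_imp_subset[OF face] that by (auto simp: cone_hull_singleton)
  have "S \<in> vectors n"
    using ray_sub[of 1] by (simp add: mem_mincut_cone_iff)
  then have proj: "coord_proj n (zero_lift n S) = S"
    by (rule coord_proj_zero_lift)
  \<comment> \<open>Scaling by 0 shows that the projection sends 0 to 0, whereas it sends the lift
    to the nonzero vector \<open>S\<close>.\<close>
  have "zero_lift n S \<noteq> 0"
    using proj \<open>S \<noteq> 0\<close> coord_proj_scaleR[of n 0 0] by force
  moreover have "cone hull {zero_lift n S} face_of mincut_cone (n + 1)"
    unfolding face_of_def
  proof (intro conjI ballI impI)
    show "cone hull {zero_lift n S} \<subseteq> mincut_cone (n + 1)"
      using ray_sub zero_lift_mem_mincut_cone
      by (fastforce simp: cone_hull_singleton simp flip: zero_lift_scaleR)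
    show "convex (cone hull {zero_lift n S})"
      by (rule convex_cone_hull) simp
    fix a b x
    assume a: "a \<in> mincut_cone (n + 1)" and b: "b \<in> mincut_cone (n + 1)"
      and "x \<in> cone hull {zero_lift n S}" and "x \<in> open_segment a b"
    then obtain c u where "0 \<le> c" and x: "x = c *\<^sub>R zero_lift n S"
      and "a \<noteq> b" and u: "0 < u" "u < 1" "x = (1 - u) *\<^sub>R a + u *\<^sub>R b"
      by (auto simp: cone_hull_singleton in_segment)
    \<comment> \<open>A combination of two nonnegative coordinates with positive coefficients
      vanishes only if both do.\<close>
    have "(1 - u) * Poly_Mapping.lookup a {n + 1} + u * Poly_Mapping.lookup b {n + 1} = 0"
      using arg_cong[OF u(3), of "\<lambda>S. Poly_Mapping.lookup S {n + 1}"] lookup_zero_lift_new[of n S]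
      by (simp add: x lookup_add lookup_scaleR)
    moreover have "0 \<le> Poly_Mapping.lookup a {n + 1}" "0 \<le> Poly_Mapping.lookup b {n + 1}"
      using a b lookup_mincut_cone_nonneg by auto
    ultimately have zero: "Poly_Mapping.lookup a {n + 1} = 0" "Poly_Mapping.lookup b {n + 1} = 0"
      using u(1,2) by (auto simp: add_nonneg_eq_0_iff)
    note pa = zero_lift_coord_proj[OF a zero(1)] and pb = zero_lift_coord_proj[OF b zero(2)]
    have "c *\<^sub>R S = (1 - u) *\<^sub>R coord_proj n a + u *\<^sub>R coord_proj n b"
      using arg_cong[OF u(3), of "coord_proj n"] by (simp add: x coord_proj_add coord_proj_scaleR proj)
    \<comment> \<open>The projected segment must not collapse, since an open segment with equal
      endpoints is empty. Distinctness survives because \<open>a\<close> and \<open>b\<close> are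
      recovered from their projections by lifting.\<close>
    moreover have "coord_proj n a \<noteq> coord_proj n b"
      using pa(2) pb(2) \<open>a \<noteq> b\<close> by metis
    ultimately have "c *\<^sub>R S \<in> open_segment (coord_proj n a) (coord_proj n b)"
      using u(1,2) by (auto simp: in_segment)
    moreover have "c *\<^sub>R S \<in> cone hull {S}"
      using \<open>0 \<le> c\<close> by (auto simp: cone_hull_singleton)
    ultimately have "coord_proj n a \<in> cone hull {S}" "coord_proj n b \<in> cone hull {S}"
      using face_ofD[OF face _ pa(1) pb(1)] by auto
    then obtain s t where "0 \<le> s" "coord_proj n a = s *\<^sub>R S" "0 \<le> t" "coord_proj n b = t *\<^sub>R S"
      by (auto simp: cone_hull_singleton)
    then show "a \<in> cone hull {zero_lift n S}" "b \<in> cone hull {zero_lift n S}"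
      using pa(2) pb(2) zero_lift_scaleR by (auto simp: cone_hull_singleton)
  qed
  ultimately show ?thesis by (simp add: extreme_ray_def)
qed

theorem proposition5:
  fixes n :: nat
  assumes "1 \<le> n"
  shows "(\<forall>S. extreme_ray (mincut_cone n) S \<longrightarrow>
              extreme_ray (mincut_cone (n + 1)) (zero_lift n S)) \<and>
         coord_proj n ` mincut_cone (n + 1) = mincut_cone n"
proof (intro conjI allI impI)
  show "coord_proj n ` mincut_cone (n + 1) = mincut_cone n"
  proof
    show "mincut_cone n \<subseteq> coord_proj n ` mincut_cone (n + 1)"
    proof
      fix S assume S: "S \<in> mincut_cone n"
      then have "S = coord_proj n (zero_lift n S)"
        by (simp add: mem_mincut_cone_iff coord_proj_zero_lift)
      then show "S \<in> coord_proj n ` mincut_cone (n + 1)"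
        using zero_lift_mem_mincut_cone[OF S] by (rule image_eqI)
    qed
  qed (use coord_proj_mem_mincut_cone in blast)
qed (rule extreme_ray_zero_lift)

end
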